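(* Let $V_h$, $A$, $\delta$, $\alpha$, $\psi$, $D=A-\delta I$ and $B_n$ be as in the context, let $\overline{w}_1\in V_h$ be given, and let $$\sigma_0=\frac{2+\alpha}{6\alpha}.$$ Then the three-level difference scheme $$B_n\frac{w_{n+1}-w_{n-1}}{2\tau}+D\big(\sigma_0 w_{n+1}+(1-2\sigma_0)w_n+\sigma_0 w_{n-1}\big)=0,\quad n=1,2,\dots,N-1,$$ $$w_0=\delta^{-\alpha}\psi,\qquad w_1=\overline{w}_1,$$ is unconditionally stable with respect to the initial data, in the sense that $\sigma_0 > \frac14$ and, for every integer $N\ge2$ with $\tau=1/N$, the approximate solution satisfies $$\mathcal{E}_{n+1}\le\mathcal{E}_n,\quad n=1,2,\dots,N-1,\qquad \mathcal{E}_n=\frac14\|w_n+w_{n-1}\|_D^2+\Big(\sigma_0-\frac14\Big)\|w_n-w_{n-1}\|_D^2 .$$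
   Context: Let $\Omega\subset\mathbb{R}^d$, $d=2,3$, be a bounded domain with Lipschitz continuous boundary, and let $(u,v)=\int_\Omega uv\,d\bm{x}$, $\|u\|=(u,u)^{1/2}$ be the inner product and norm of $L_2(\Omega)$. Let $V_h\subset H^1(\Omega)$ be a (finite-dimensional) finite element space with the inner product and norm of $L_2(\Omega)$. Let $$a(u,v)=\int_\Omega \big(k\,\mathrm{grad}\,u\cdot \mathrm{grad}\,v + c\,uv\big)d\bm{x}+\int_{\partial\Omega}\mu\,uv\,d\bm{x},$$ where $0<k_1\le k(\bm{x})\le k_2$, $c(\bm{x})\ge c_0>0$ and $\mu(\bm{x})\ge 0$. The discrete elliptic operator $A:V_h\to V_h$ is defined by $(Au,v)=a(u,v)$ for all $u,v\in V_h$. It is assumed that $\delta>0$ is a constant such that $A=A^*>\delta I$, i.e. $A$ is self-adjoint and $(Au,u)>\delta\|u\|^2$ for all nonzero $u\in V_h$. Here $I$ is the identity operator. Put $D=A-\delta I$, so $D=D^*>0$. Let $0<\alpha<1$ and $\psi\in V_h$. Time grid: $N\tau=1$, $t_n=n\tau$, and $w_n\in V_h$ denotes the approximation at time $t_n$, $n=0,1,\dots,N$. The operator $B(t)=\frac1\alpha(tD+\delta I)$ and $B_n=B(t_n)$. For a self-adjoint positive operator $S$, $\|y\|_S=(Sy,y)^{1/2}$. *)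

theory Defs
  imports "HOL-Analysis.Analysis"
begin

section \<open>Hausdorff measure and surface measure\<close>

definition hausdorff_gauge :: "nat \<Rightarrow> real \<Rightarrow> 'a::metric_space set \<Rightarrow> ennreal" where
  "hausdorff_gauge m r C = (if bounded C \<and> diameter C \<le> r then ennreal (diameter C ^ m) else top)"

text \<open>
  For \<open>m > 0\<close> only. The gauge is \<open>\<infinity>\<close> on sets of diameter exceeding \<open>r\<close>, so only covers of mesh at
  most \<open>r\<close> count; disjointness of the covers in \<open>outer_measure\<close> is no restriction here. The
  normalisation makes the \<open>m\<close>-dimensional measure agree with surface area.
\<close>
definition hausdorff_outer :: "nat \<Rightarrow> 'a::metric_space set \<Rightarrow> ennreal" where
  "hausdorff_outer m A = ennreal (unit_ball_vol (real m) / 2 ^ m) *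
     (SUP r\<in>{0<..}. outer_measure UNIV (hausdorff_gauge m r) A)"

definition hausdorff_measure :: "nat \<Rightarrow> 'a::metric_space measure" where
  "hausdorff_measure m =
     measure_of UNIV (lambda_system UNIV UNIV (hausdorff_outer m)) (hausdorff_outer m)"

definition surface_measure :: "(real ^ 'n::finite) set \<Rightarrow> (real ^ 'n) measure" where
  "surface_measure \<Omega> = restrict_space (hausdorff_measure (CARD('n) - 1)) (frontier \<Omega>)"

subsection \<open>The Hausdorff measure is a Borel measure\<close>

text \<open>
  \<open>measure_of\<close> is the zero measure if its argument is not a measure, so this is verified here.
\<close>

lemma ring_UNIV: "ring_of_sets UNIV (UNIV :: 'a set set)"
proof -
  interpret sigma_algebra "UNIV :: 'a set" UNIV
    using sigma_algebra_Pow[of UNIV] by simp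
  show ?thesis by (rule ring_of_sets_axioms)
qed

lemma gauge_positive: "m > 0 \<Longrightarrow> r > 0 \<Longrightarrow> positive UNIV (hausdorff_gauge m r)"
  by (simp add: positive_def hausdorff_gauge_def)

lemma gauge_increasing: "increasing UNIV (hausdorff_gauge m r)"
  unfolding increasing_def
proof safe
  fix A B :: "'a set" assume AB: "A \<subseteq> B"
  show "hausdorff_gauge m r A \<le> hausdorff_gauge m r B"
  proof (cases "bounded B \<and> diameter B \<le> r")
    case True
    then have "bounded A" "diameter A \<le> diameter B"
      using AB bounded_subset diameter_subset by auto
    with True show ?thesis
      by (simp add: hausdorff_gauge_def ennreal_leI power_mono diameter_ge_0)
  next
    case False
    then have "hausdorff_gauge m r B = top" unfolding hausdorff_gauge_def by (rule if_not_P)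
    then show ?thesis by simp
  qed
qed

lemma gauge_outer:
  assumes "m > 0" "r > 0"
  shows "outer_measure_space UNIV (outer_measure UNIV (hausdorff_gauge m r))"
  using ring_of_sets.outer_measure_space_outer_measure[OF ring_UNIV gauge_positive[OF assms] gauge_increasing]
  by simp

lemma outer_measure_hausdorff_outer:
  assumes m: "m > 0"
  shows "outer_measure_space UNIV (hausdorff_outer m :: 'a::metric_space set \<Rightarrow> ennreal)"
proof -
  let ?o = "\<lambda>r. outer_measure UNIV (hausdorff_gauge m r) :: 'a set \<Rightarrow> ennreal"
  have o: "positive UNIV (?o r)" "increasing UNIV (?o r)" "countably_subadditive UNIV (?o r)"
    if "r > 0" for r
    using gauge_outer[OF m that] by (auto simp: outer_measure_space_def)
  have "positive UNIV (hausdorff_outer m :: 'a set \<Rightarrow> ennreal)"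
    using o(1) by (auto simp: positive_def hausdorff_outer_def)
  moreover have "increasing UNIV (hausdorff_outer m :: 'a set \<Rightarrow> ennreal)"
    using o(2) unfolding increasing_def hausdorff_outer_def
    by (intro ballI impI mult_left_mono SUP_mono) (auto intro!: bexI)
  moreover have "countably_subadditive UNIV (hausdorff_outer m :: 'a set \<Rightarrow> ennreal)"
    unfolding countably_subadditive_def
  proof safe
    fix A :: "nat \<Rightarrow> 'a set" assume "disjoint_family A"
    have "?o r (\<Union>(range A)) \<le> (\<Sum>i. SUP r\<in>{0<..}. ?o r (A i))" if "r > 0" for r
    proof -
      have "?o r (\<Union>(range A)) \<le> (\<Sum>i. ?o r (A i))"
        using o(3)[OF that] \<open>disjoint_family A\<close> by (simp add: countably_subadditive_def)
      also have "\<dots> \<le> (\<Sum>i. SUP r\<in>{0<..}. ?o r (A i))"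
        using that by (intro suminf_le SUP_upper) auto
      finally show ?thesis .
    qed
    then show "hausdorff_outer m (\<Union>(range A)) \<le> (\<Sum>i. hausdorff_outer m (A i))"
      unfolding hausdorff_outer_def ennreal_suminf_cmult
      by (auto intro!: mult_left_mono SUP_least)
  qed
  ultimately show ?thesis by (simp add: outer_measure_space_def)
qed

lemma metric_outer_closed:
  fixes f :: "'a::metric_space set \<Rightarrow> ennreal"
  assumes f: "outer_measure_space UNIV f"
    and metric: "\<And>A B e. e > 0 \<Longrightarrow> (\<And>x y. x \<in> A \<Longrightarrow> y \<in> B \<Longrightarrow> e \<le> dist x y) \<Longrightarrow> f A + f B \<le> f (A \<union> B)"
    and F: "closed F"
  shows "F \<in> lambda_system UNIV UNIV f"
proof -
  have pos: "positive UNIV f" and inc: "increasing UNIV f" and csa: "countably_subadditive UNIV f"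
    using f by (auto simp: outer_measure_space_def)
  have mono: "f X \<le> f Y" if "X \<subseteq> Y" for X Y
    using inc that by (simp add: increasing_def)
  interpret U: sigma_algebra "UNIV :: 'a set" UNIV
    using sigma_algebra_Pow[of UNIV] by simp
  have sub: "f (X \<union> Y) \<le> f X + f Y" for X Y
  proof -
    have "f (X \<union> (Y - X)) \<le> f X + f (Y - X)"
      using U.countably_subadditive_subadditive[OF pos csa]
      unfolding subadditive_def by blast
    also have "\<dots> \<le> f X + f Y" by (intro add_left_mono mono) auto
    finally show ?thesis by simp
  qed
  have csub: "f (\<Union>i. X i) \<le> (\<Sum>i. f (X i))" for X :: "nat \<Rightarrow> 'a set"
  proof -
    have "f (\<Union>i. disjointed X i) \<le> (\<Sum>i. f (disjointed X i))"
      using csa disjoint_family_disjointed by (auto simp: countably_subadditive_def)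
    also have "\<dots> \<le> (\<Sum>i. f (X i))"
      by (intro suminf_le mono disjointed_subset) auto
    finally show ?thesis by (simp add: UN_disjointed_eq)
  qed
  have key: "f (u \<inter> F) + f (u - F) \<le> f u" for u
  proof (cases "F = {} \<or> f u = top")
    case True
    then show ?thesis
      using pos by (auto simp: positive_def)
  next
    case False
    then have F0: "F \<noteq> {}" and fu: "f u < top" by (auto simp: less_top)
    define A where "A n = {x\<in>u. 1 / real (Suc n) \<le> infdist x F}" for n
    define R where "R n = A (Suc n) - A n" for n
    have Amono: "A n \<subseteq> A (Suc n)" for n
    proof -
      have "1 / real (Suc (Suc n)) \<le> 1 / real (Suc n)" by (simp add: frac_le)
      then show ?thesis unfolding A_def by fastforce
    qed
    have Rlow: "1 / real (n + 2) \<le> infdist x F" if "x \<in> R n" for x n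
      using that by (simp add: R_def A_def add.commute)
    have Rup: "infdist x F < 1 / real (n + 1)" if "x \<in> R n" for x n
      using that by (auto simp: R_def A_def)
    have Ru: "R n \<subseteq> u" for n by (auto simp: R_def A_def)
    have UA: "u - F = (\<Union>n. A n)"
    proof safe
      fix x assume x: "x \<in> u" "x \<notin> F"
      then have "infdist x F > 0"
        using F F0 in_closed_iff_infdist_zero infdist_nonneg[of x F] by (metis less_eq_real_def)
      then obtain n where "inverse (real (Suc n)) < infdist x F"
        using reals_Archimedean by blast
      then show "x \<in> (\<Union>n. A n)" using x by (auto simp: A_def inverse_eq_divide intro!: exI[of _ n])
    next
      fix x n assume "x \<in> A n" "x \<in> F"
      then show False by (auto simp: A_def)
    qed (auto simp: A_def)
    have chain: "(\<Sum>i<n. f (R (2 * i + p))) \<le> f (\<Union>i<n. R (2 * i + p))" for n p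
    proof (induction n)
      case (Suc n)
      have sep: "f (\<Union>i<n. R (2 * i + p)) + f (R (2 * n + p)) \<le> f ((\<Union>i<n. R (2 * i + p)) \<union> R (2 * n + p))"
      proof (cases "n = 0")
        case True
        then show ?thesis using pos by (simp add: positive_def)
      next
        case False
        show ?thesis
        proof (rule metric[where e = "1 / real (2 * n + p) - 1 / real (2 * n + p + 1)"])
          show "1 / real (2 * n + p) - 1 / real (2 * n + p + 1) > 0"
            using False by (simp add: frac_less2)
          fix x y assume x: "x \<in> (\<Union>i<n. R (2 * i + p))" and y: "y \<in> R (2 * n + p)"
          from x obtain i where i: "i < n" "x \<in> R (2 * i + p)" by auto
          have "1 / real (2 * n + p) \<le> 1 / real (2 * i + p + 2)"
            using i(1) False by (intro divide_left_mono) (auto intro!: mult_pos_pos)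
          also have "\<dots> \<le> infdist x F" using Rlow[OF i(2)] .
          finally have "1 / real (2 * n + p) \<le> infdist x F" .
          moreover have "infdist x F \<le> infdist y F + dist x y" by (rule infdist_triangle)
          ultimately show "1 / real (2 * n + p) - 1 / real (2 * n + p + 1) \<le> dist x y"
            using Rup[OF y] by linarith
        qed
      qed
      have "(\<Sum>i<Suc n. f (R (2 * i + p))) \<le> f (\<Union>i<n. R (2 * i + p)) + f (R (2 * n + p))"
        using Suc by (simp add: add_right_mono)
      also note sep
      finally show ?case by (simp add: lessThan_Suc Un_commute)
    qed (simp)
    have part: "(\<Sum>i<n. f (R (2 * i + p))) \<le> f u" for n p
      using chain[where n=n and p=p] mono[of "\<Union>i<n. R (2 * i + p)" u] Ru by (meson UN_least order_trans)
    have "(\<Sum>i<2 * n. f (R i)) = (\<Sum>i<n. f (R (2 * i + 0))) + (\<Sum>i<n. f (R (2 * i + 1)))" for n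
      by (induction n) (simp_all add: ac_simps)
    then have "(\<Sum>i<2 * n. f (R i)) \<le> f u + f u" for n
      using part[where n=n and p=0] part[where n=n and p=1] by (metis add_mono)
    moreover have "(\<Sum>i<n. f (R i)) \<le> (\<Sum>i<2 * n. f (R i))" for n
      by (intro sum_mono2) auto
    ultimately have "(\<Sum>i. f (R i)) \<le> f u + f u"
      by (intro suminf_le_const) (auto intro: order_trans)
    also have "f u + f u < top" using fu by simp
    finally have S: "(\<Sum>i. f (R i)) < top" .
    have stage: "f (u \<inter> F) + f (A n) \<le> f u" for n
    proof -
      have "f (u \<inter> F) + f (A n) \<le> f ((u \<inter> F) \<union> A n)"
      proof (rule metric[where e = "1 / real (Suc n)"])
        fix x y assume "x \<in> u \<inter> F" "y \<in> A n"
        then have "1 / real (Suc n) \<le> infdist y F" "infdist y F \<le> dist y x"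
          by (auto simp: A_def intro: infdist_le)
        then show "1 / real (Suc n) \<le> dist x y" by (simp add: dist_commute)
      qed simp
      also have "\<dots> \<le> f u" by (intro mono) (auto simp: A_def)
      finally show ?thesis .
    qed
    have tail: "f (u - F) \<le> f (A n) + (\<Sum>i. f (R (i + n)))" for n
    proof -
      have "A k \<subseteq> A n \<union> (\<Union>i. R (i + n))" for k
      proof (induction k)
        case 0
        have "A 0 \<subseteq> A n" by (induction n) (use Amono in blast)+
        then show ?case by auto
      next
        case (Suc k)
        show ?case
        proof (cases "k < n")
          case True
          then have "A (Suc k) \<subseteq> A n" using lift_Suc_mono_le[of A "Suc k" n] Amono by simp
          then show ?thesis by auto
        next
          case False
          then have "R k = R ((k - n) + n)" by simp
          then have "A (Suc k) \<subseteq> A k \<union> (\<Union>i. R (i + n))" by (auto simp: R_def)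
          then show ?thesis using Suc by blast
        qed
      qed
      then have "f (u - F) \<le> f (A n \<union> (\<Union>i. R (i + n)))"
        unfolding UA by (intro mono) blast
      also have "\<dots> \<le> f (A n) + f (\<Union>i. R (i + n))" by (rule sub)
      also have "\<dots> \<le> f (A n) + (\<Sum>i. f (R (i + n)))" by (intro add_left_mono csub)
      finally show ?thesis .
    qed
    let ?S = "\<Sum>i. f (R i)"
    have fin: "(f (u \<inter> F) + f (u - F)) + (\<Sum>i<n. f (R i)) \<le> f u + ?S" for n
    proof -
      have "(f (u \<inter> F) + f (u - F)) + (\<Sum>i<n. f (R i))
          \<le> (f (u \<inter> F) + (f (A n) + (\<Sum>i. f (R (i + n))))) + (\<Sum>i<n. f (R i))"
        by (intro add_mono tail order_refl)
      also have "\<dots> = (f (u \<inter> F) + f (A n)) + ((\<Sum>i. f (R (i + n))) + (\<Sum>i<n. f (R i)))"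
        by (simp add: ac_simps)
      also have "(\<Sum>i. f (R (i + n))) + (\<Sum>i<n. f (R i)) = ?S"
        using suminf_offset[of "\<lambda>i. f (R i)" n] by (simp add: add.commute[of _ "\<Sum>i<n. f (R i)"])
      also have "f (u \<inter> F) + f (A n) + ?S \<le> f u + ?S" by (intro add_right_mono stage)
      finally show ?thesis .
    qed
    have "(f (u \<inter> F) + f (u - F)) + ?S \<le> f u + ?S"
    proof (rule LIMSEQ_le_const2)
      show "(\<lambda>n. (f (u \<inter> F) + f (u - F)) + (\<Sum>i<n. f (R i))) \<longlonglongrightarrow> (f (u \<inter> F) + f (u - F)) + ?S"
        by (intro tendsto_add tendsto_const summable_LIMSEQ) auto
    qed (use fin in auto)
    then show ?thesis using S by (auto simp: ennreal_add_left_cancel_le add.commute[of _ ?S])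
  qed
  have "f u \<le> f (u \<inter> F) + f (u - F)" for u
    using sub[of "u \<inter> F" "u - F"] by (metis Int_Diff_Un)
  with key have "f (F \<inter> u) + f ((UNIV - F) \<inter> u) = f u" for u
    by (metis Compl_eq_Diff_UNIV Diff_eq Int_commute order_antisym)
  then show ?thesis by (simp add: lambda_system_def)
qed

lemma hausdorff_outer_metric:
  fixes A B :: "'a::metric_space set"
  assumes m: "m > 0" and e: "e > 0"
    and sep: "\<And>x y. x \<in> A \<Longrightarrow> y \<in> B \<Longrightarrow> e \<le> dist x y"
  shows "hausdorff_outer m A + hausdorff_outer m B \<le> hausdorff_outer m (A \<union> B)"
proof -
  let ?g = "\<lambda>r. hausdorff_gauge m r :: 'a set \<Rightarrow> ennreal"
  let ?o = "\<lambda>r. outer_measure UNIV (?g r)"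
  note le = ring_of_sets.outer_measure_le[OF ring_UNIV gauge_positive[OF m] gauge_increasing]
  have small: "?o r A + ?o r B \<le> ?o r (A \<union> B)" if r: "0 < r" "r < e" for r
    unfolding outer_measure_def[of UNIV _ "A \<union> B"]
  proof (rule INF_greatest, clarify)
    fix C :: "nat \<Rightarrow> 'a set" assume cov: "A \<union> B \<subseteq> (\<Union>i. C i)"
    have "?g r (C i \<inter> A) + ?g r (C i \<inter> B) \<le> ?g r (C i)" for i
    proof (cases "C i \<inter> A = {} \<or> C i \<inter> B = {}")
      case True
      moreover have "?g r {} = 0" "?g r (C i \<inter> X) \<le> ?g r (C i)" for X
        using gauge_positive[OF m r(1)]
        by (auto simp: positive_def intro: increasingD[OF gauge_increasing])
      ultimately show ?thesis by (metis add.left_neutral add.right_neutral)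
    next
      case False
      then obtain x y where xy: "x \<in> C i" "x \<in> A" "y \<in> C i" "y \<in> B" by auto
      have "\<not> (bounded (C i) \<and> diameter (C i) \<le> r)"
        using diameter_bounded_bound[of "C i" x y] xy sep[of x y] r by fastforce
      then have "?g r (C i) = top" unfolding hausdorff_gauge_def by (rule if_not_P)
      then show ?thesis by simp
    qed
    then have "(\<Sum>i. ?g r (C i \<inter> A)) + (\<Sum>i. ?g r (C i \<inter> B)) \<le> (\<Sum>i. ?g r (C i))"
      by (subst suminf_add) (auto intro!: suminf_le)
    moreover have "?o r A \<le> (\<Sum>i. ?g r (C i \<inter> A))" "?o r B \<le> (\<Sum>i. ?g r (C i \<inter> B))"
      using cov by (auto intro!: le r)
    ultimately show "?o r A + ?o r B \<le> (\<Sum>i. ?g r (C i))"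
      by (meson add_mono order_trans)
  qed
  have anti: "?o r X \<le> ?o s X" if "s \<le> r" for r s X
    unfolding outer_measure_def using that
    by (intro INF_mono) (force simp: hausdorff_gauge_def intro!: suminf_le)
  have "?o r A + ?o s B \<le> (SUP r\<in>{0<..}. ?o r (A \<union> B))" if "r > 0" "s > 0" for r s
  proof -
    define q where "q = min (e / 2) (min r s)"
    have q: "0 < q" "q < e" "q \<le> r" "q \<le> s" using that e by (auto simp: q_def)
    have "?o r A + ?o s B \<le> ?o q A + ?o q B" by (intro add_mono anti q)
    also have "\<dots> \<le> ?o q (A \<union> B)" by (rule small[OF q(1,2)])
    also have "\<dots> \<le> (SUP r\<in>{0<..}. ?o r (A \<union> B))" using q by (intro SUP_upper) auto
    finally show ?thesis .
  qed
  then have "(SUP r\<in>{0<..}. ?o r A) + (SUP r\<in>{0<..}. ?o r B) \<le> (SUP r\<in>{0<..}. ?o r (A \<union> B))"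
    by (auto simp: ennreal_SUP_add_left[symmetric] ennreal_SUP_add_right intro!: SUP_least)
  then show ?thesis
    unfolding hausdorff_outer_def distrib_left[symmetric] by (intro mult_left_mono) auto
qed

lemma
  fixes X :: "'a::metric_space set"
  assumes m: "m > 0"
  shows space_hausdorff: "space (hausdorff_measure m :: 'a measure) = UNIV"
    and sets_hausdorff: "sets (hausdorff_measure m :: 'a measure) = lambda_system UNIV UNIV (hausdorff_outer m)"
    and borel_hausdorff: "sets borel \<subseteq> sets (hausdorff_measure m :: 'a measure)"
    and emeasure_hausdorff: "X \<in> sets (hausdorff_measure m) \<Longrightarrow> emeasure (hausdorff_measure m) X = hausdorff_outer m X"
proof -
  interpret U: sigma_algebra "UNIV :: 'a set" UNIV
    using sigma_algebra_Pow[of UNIV] by simp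
  have ms: "measure_space UNIV (lambda_system UNIV UNIV (hausdorff_outer m)) (hausdorff_outer m :: 'a set \<Rightarrow> ennreal)"
    using U.caratheodory_lemma[OF outer_measure_hausdorff_outer[OF m]] .
  then interpret L: sigma_algebra "UNIV :: 'a set" "lambda_system UNIV UNIV (hausdorff_outer m)"
    by (simp add: measure_space_def)
  show "space (hausdorff_measure m :: 'a measure) = UNIV"
    by (simp add: hausdorff_measure_def)
  show sets: "sets (hausdorff_measure m :: 'a measure) = lambda_system UNIV UNIV (hausdorff_outer m)"
    by (simp add: hausdorff_measure_def)
  have "F \<in> lambda_system UNIV UNIV (hausdorff_outer m)" if "closed F" for F :: "'a set"
    by (rule metric_outer_closed[OF outer_measure_hausdorff_outer[OF m] hausdorff_outer_metric[OF m] that])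
  then show "sets borel \<subseteq> sets (hausdorff_measure m :: 'a measure)"
    unfolding sets borel_eq_closed by (subst sets_measure_of) (auto intro!: L.sigma_sets_subset)
  show "emeasure (hausdorff_measure m) X = hausdorff_outer m X" if "X \<in> sets (hausdorff_measure m)"
    using ms that unfolding sets
    by (intro emeasure_measure_of[OF hausdorff_measure_def])
       (auto simp: measure_space_def sets)
qed


section \<open>The Sobolev space of order one, and traces\<close>

definition lipschitz_boundary :: "(real ^ 'n::finite) set \<Rightarrow> bool" where
  "lipschitz_boundary \<Omega> \<longleftrightarrow> (\<forall>p\<in>frontier \<Omega>. \<exists>U e g L.
     open U \<and> p \<in> U \<and> norm e = 1 \<and> L-lipschitz_on {z. z \<bullet> e = 0} g \<and>
     \<Omega> \<inter> U = {x\<in>U. g (x - (x \<bullet> e) *\<^sub>R e) < x \<bullet> e})"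

definition bounded_lipschitz_domain :: "(real ^ 'n::finite) set \<Rightarrow> bool" where
  "bounded_lipschitz_domain \<Omega> \<longleftrightarrow>
     open \<Omega> \<and> connected \<Omega> \<and> \<Omega> \<noteq> {} \<and> bounded \<Omega> \<and> lipschitz_boundary \<Omega>"

text \<open>\<open>P \<alpha>\<close> is the iterated partial derivative in the directions listed by \<open>\<alpha>\<close>.\<close>
definition smooth :: "(real ^ 'n::finite \<Rightarrow> real) \<Rightarrow> bool" where
  "smooth \<phi> \<longleftrightarrow> (\<exists>P :: 'n list \<Rightarrow> real ^ 'n \<Rightarrow> real. P [] = \<phi> \<and>
     (\<forall>\<alpha> x. (P \<alpha> has_derivative (\<lambda>h. \<Sum>i\<in>UNIV. P (i # \<alpha>) x * h $ i)) (at x)))"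

definition test_function :: "(real ^ 'n::finite) set \<Rightarrow> (real ^ 'n \<Rightarrow> real) \<Rightarrow> bool" where
  "test_function \<Omega> \<phi> \<longleftrightarrow>
     smooth \<phi> \<and> compact (closure {x. \<phi> x \<noteq> 0}) \<and> closure {x. \<phi> x \<noteq> 0} \<subseteq> \<Omega>"

definition gradient :: "(real ^ 'n::finite \<Rightarrow> real) \<Rightarrow> real ^ 'n \<Rightarrow> real ^ 'n" where
  "gradient \<phi> x = (\<chi> i. frechet_derivative \<phi> (at x) (axis i 1))"

definition square_integrable :: "'a measure \<Rightarrow> ('a \<Rightarrow> real) \<Rightarrow> bool" where
  "square_integrable M u \<longleftrightarrow> u \<in> borel_measurable M \<and> integrable M (\<lambda>x. (u x)\<^sup>2)"

definition has_weak_gradient ::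
    "(real ^ 'n::finite) set \<Rightarrow> (real ^ 'n \<Rightarrow> real) \<Rightarrow> (real ^ 'n \<Rightarrow> real ^ 'n) \<Rightarrow> bool" where
  "has_weak_gradient \<Omega> u G \<longleftrightarrow>
     (\<forall>i. square_integrable (lebesgue_on \<Omega>) (\<lambda>x. G x $ i)) \<and>
     (\<forall>\<phi> i. test_function \<Omega> \<phi> \<longrightarrow>
        (LINT x|lebesgue_on \<Omega>. u x * gradient \<phi> x $ i) = - (LINT x|lebesgue_on \<Omega>. G x $ i * \<phi> x))"

text \<open>Elements are representatives; equality in \<open>L\<^sub>2(\<Omega>)\<close> is the relation \<open>ae_eq\<close>.\<close>
definition sobolev_H1 :: "(real ^ 'n::finite) set \<Rightarrow> (real ^ 'n \<Rightarrow> real) set" where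
  "sobolev_H1 \<Omega> = {u. square_integrable (lebesgue_on \<Omega>) u \<and> (\<exists>G. has_weak_gradient \<Omega> u G)}"

definition ae_eq :: "(real ^ 'n::finite) set \<Rightarrow> (real ^ 'n \<Rightarrow> real) \<Rightarrow> (real ^ 'n \<Rightarrow> real) \<Rightarrow> bool" where
  "ae_eq \<Omega> u v \<longleftrightarrow> (AE x in lebesgue_on \<Omega>. u x = v x)"

text \<open>The weak gradient is unique almost everywhere, so the choice does not affect integrals.\<close>
definition weak_gradient :: "(real ^ 'n::finite) set \<Rightarrow> (real ^ 'n \<Rightarrow> real) \<Rightarrow> real ^ 'n \<Rightarrow> real ^ 'n" where
  "weak_gradient \<Omega> u = (SOME G. has_weak_gradient \<Omega> u G)"

text \<open>
  The trace operator is the continuous extension to \<open>H\<^sup>1(\<Omega>)\<close> of restriction to the boundary, which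
  is defined on the dense subspace of functions smooth up to the boundary.
\<close>
definition has_trace :: "(real ^ 'n::finite) set \<Rightarrow> (real ^ 'n \<Rightarrow> real) \<Rightarrow> (real ^ 'n \<Rightarrow> real) \<Rightarrow> bool" where
  "has_trace \<Omega> u g \<longleftrightarrow> square_integrable (surface_measure \<Omega>) g \<and>
     (\<exists>\<phi> :: nat \<Rightarrow> real ^ 'n \<Rightarrow> real. (\<forall>m. smooth (\<phi> m)) \<and>
        (\<lambda>m. LINT x|lebesgue_on \<Omega>. (\<phi> m x - u x)\<^sup>2 + (norm (gradient (\<phi> m) x - weak_gradient \<Omega> u x))\<^sup>2)
          \<longlonglongrightarrow> 0 \<and>
        (\<lambda>m. LINT x|surface_measure \<Omega>. (\<phi> m x - g x)\<^sup>2) \<longlonglongrightarrow> 0)"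

definition boundary_trace :: "(real ^ 'n::finite) set \<Rightarrow> (real ^ 'n \<Rightarrow> real) \<Rightarrow> real ^ 'n \<Rightarrow> real" where
  "boundary_trace \<Omega> u = (SOME g. has_trace \<Omega> u g)"

section \<open>The discrete problem\<close>

definition inner_L2 :: "(real ^ 'n::finite) set \<Rightarrow> (real ^ 'n \<Rightarrow> real) \<Rightarrow> (real ^ 'n \<Rightarrow> real) \<Rightarrow> real" where
  "inner_L2 \<Omega> u v = (LINT x|lebesgue_on \<Omega>. u x * v x)"

definition norm_L2 :: "(real ^ 'n::finite) set \<Rightarrow> (real ^ 'n \<Rightarrow> real) \<Rightarrow> real" where
  "norm_L2 \<Omega> u = sqrt (inner_L2 \<Omega> u u)"

definition elliptic_form :: "(real ^ 'n::finite) set \<Rightarrow> (real ^ 'n \<Rightarrow> real) \<Rightarrow> (real ^ 'n \<Rightarrow> real) \<Rightarrow>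
    (real ^ 'n \<Rightarrow> real) \<Rightarrow> (real ^ 'n \<Rightarrow> real) \<Rightarrow> (real ^ 'n \<Rightarrow> real) \<Rightarrow> real" where
  "elliptic_form \<Omega> k c \<mu> u v =
     (LINT x|lebesgue_on \<Omega>. k x * (weak_gradient \<Omega> u x \<bullet> weak_gradient \<Omega> v x) + c x * u x * v x) +
     (LINT x|surface_measure \<Omega>. \<mu> x * boundary_trace \<Omega> u x * boundary_trace \<Omega> v x)"

definition finite_element_space :: "(real ^ 'n::finite) set \<Rightarrow> (real ^ 'n \<Rightarrow> real) set \<Rightarrow> bool" where
  "finite_element_space \<Omega> V \<longleftrightarrow> V \<subseteq> sobolev_H1 \<Omega> \<and> (\<lambda>x. 0) \<in> V \<and>
     (\<forall>u\<in>V. \<forall>v\<in>V. \<forall>a b. (\<lambda>x. a * u x + b * v x) \<in> V) \<and>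
     (\<exists>S. finite S \<and> S \<subseteq> V \<and> (\<forall>u\<in>V. \<exists>a. ae_eq \<Omega> u (\<lambda>x. \<Sum>s\<in>S. a s * s x)))"

type_synonym 'n operator = "(real ^ 'n \<Rightarrow> real) \<Rightarrow> real ^ 'n \<Rightarrow> real"

definition discrete_elliptic_operator :: "(real ^ 'n::finite) set \<Rightarrow> (real ^ 'n \<Rightarrow> real) set \<Rightarrow>
    (real ^ 'n \<Rightarrow> real) \<Rightarrow> (real ^ 'n \<Rightarrow> real) \<Rightarrow> (real ^ 'n \<Rightarrow> real) \<Rightarrow> 'n operator \<Rightarrow> bool" where
  "discrete_elliptic_operator \<Omega> V k c \<mu> A \<longleftrightarrow>
     (\<forall>u\<in>V. A u \<in> V) \<and> (\<forall>u\<in>V. \<forall>v\<in>V. inner_L2 \<Omega> (A u) v = elliptic_form \<Omega> k c \<mu> u v)"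

text \<open>Linearity up to null sets is a consequence of self-adjointness on \<open>V\<close>.\<close>
definition self_adjoint_on :: "(real ^ 'n::finite) set \<Rightarrow> (real ^ 'n \<Rightarrow> real) set \<Rightarrow> 'n operator \<Rightarrow> bool" where
  "self_adjoint_on \<Omega> V S \<longleftrightarrow> (\<forall>u\<in>V. \<forall>v\<in>V. inner_L2 \<Omega> (S u) v = inner_L2 \<Omega> u (S v))"

definition op_D :: "real \<Rightarrow> 'n::finite operator \<Rightarrow> 'n operator" where
  "op_D \<delta> A u = (\<lambda>x. A u x - \<delta> * u x)"

definition op_B :: "real \<Rightarrow> real \<Rightarrow> 'n::finite operator \<Rightarrow> real \<Rightarrow> 'n operator" where
  "op_B \<alpha> \<delta> A t u = (\<lambda>x. 1 / \<alpha> * (t * op_D \<delta> A u x + \<delta> * u x))"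

definition op_norm :: "(real ^ 'n::finite) set \<Rightarrow> 'n operator \<Rightarrow> (real ^ 'n \<Rightarrow> real) \<Rightarrow> real" where
  "op_norm \<Omega> S y = sqrt (inner_L2 \<Omega> (S y) y)"

definition three_level_scheme :: "(real ^ 'n::finite) set \<Rightarrow> real \<Rightarrow> real \<Rightarrow> 'n operator \<Rightarrow> real \<Rightarrow>
    nat \<Rightarrow> real \<Rightarrow> (nat \<Rightarrow> real ^ 'n \<Rightarrow> real) \<Rightarrow> bool" where
  "three_level_scheme \<Omega> \<alpha> \<delta> A \<sigma> N \<tau> w \<longleftrightarrow> (\<forall>n\<in>{1..N - 1}. ae_eq \<Omega>
     (\<lambda>x. op_B \<alpha> \<delta> A (real n * \<tau>) (\<lambda>y. (w (n + 1) y - w (n - 1) y) / (2 * \<tau>)) x +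
          op_D \<delta> A (\<lambda>y. \<sigma> * w (n + 1) y + (1 - 2 * \<sigma>) * w n y + \<sigma> * w (n - 1) y) x)
     (\<lambda>x. 0))"

definition energy :: "(real ^ 'n::finite) set \<Rightarrow> 'n operator \<Rightarrow> real \<Rightarrow> (nat \<Rightarrow> real ^ 'n \<Rightarrow> real) \<Rightarrow> nat \<Rightarrow> real" where
  "energy \<Omega> D \<sigma> w n =
     1 / 4 * (op_norm \<Omega> D (\<lambda>x. w n x + w (n - 1) x))\<^sup>2 +
     (\<sigma> - 1 / 4) * (op_norm \<Omega> D (\<lambda>x. w n x - w (n - 1) x))\<^sup>2"

end

theory Submission
  imports Defs
begin

text \<open>
  The energy law comes from testing the scheme with \<open>v = w\<^sub>n\<^sub>+\<^sub>1 - w\<^sub>n\<^sub>-\<^sub>1\<close>. The weighted average splits as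
  \<open>\<sigma> w\<^sub>n\<^sub>+\<^sub>1 + (1 - 2\<sigma>) w\<^sub>n + \<sigma> w\<^sub>n\<^sub>-\<^sub>1
    = 1/4 (w\<^sub>n\<^sub>+\<^sub>1 + 2 w\<^sub>n + w\<^sub>n\<^sub>-\<^sub>1) + (\<sigma> - 1/4) (w\<^sub>n\<^sub>+\<^sub>1 - 2 w\<^sub>n + w\<^sub>n\<^sub>-\<^sub>1)\<close>,
  and \<open>v\<close> is the difference of the two sums \<open>w\<^sub>n\<^sub>+\<^sub>1 + w\<^sub>n\<close>, \<open>w\<^sub>n + w\<^sub>n\<^sub>-\<^sub>1\<close>, whose sum is the first
  bracket; it is also the sum of the two increments \<open>w\<^sub>n\<^sub>+\<^sub>1 - w\<^sub>n\<close>, \<open>w\<^sub>n - w\<^sub>n\<^sub>-\<^sub>1\<close>, whose difference is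
  the second bracket. Since \<open>D\<close> is self-adjoint, each product of a sum with a difference is a
  difference of squares, so the \<open>D\<close>-term of the tested scheme is exactly \<open>\<E>\<^sub>n\<^sub>+\<^sub>1 - \<E>\<^sub>n\<close>
  (\<open>symmetric_form_three_level_identity\<close>). What remains is
  \<open>\<E>\<^sub>n\<^sub>+\<^sub>1 - \<E>\<^sub>n = - (B\<^sub>n v, v) / (2\<tau>)\<close>, and \<open>B\<^sub>n\<close> is nonnegative because it is a combination of \<open>D\<close> and
  the identity with nonnegative coefficients. Neither step restricts \<open>\<tau>\<close>. The
  bound \<open>\<sigma>\<^sub>0 > 1/4\<close>, which makes both terms of the energy nonnegative, amounts to \<open>4 + 2\<alpha> > 3\<alpha>\<close>.

  The elements of \<open>V\<close> are representatives of classes of functions, so \<open>A\<close> is linear only up to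
  null sets. For this reason the argument runs through the form \<open>(u, v) \<mapsto> (Du, v)\<close>: it is linear in
  \<open>v\<close> because the integral is, hence in \<open>u\<close> by symmetry.
\<close>

section \<open>The inner product on square integrable functions\<close>

lemma integrable_mult_square_integrable:
  assumes "square_integrable M f" "square_integrable M g"
  shows "integrable M (\<lambda>x. f x * g x)"
proof (rule Bochner_Integration.integrable_bound)
  show "integrable M (\<lambda>x. (f x)\<^sup>2 + (g x)\<^sup>2)"
    and "(\<lambda>x. f x * g x) \<in> borel_measurable M"
    using assms by (auto simp: square_integrable_def)
  have "\<bar>a * b\<bar> \<le> a\<^sup>2 + b\<^sup>2" for a b :: real
  proof -
    have "2 * \<bar>a\<bar> * \<bar>b\<bar> \<le> a\<^sup>2 + b\<^sup>2"
      using sum_squares_bound[of "\<bar>a\<bar>" "\<bar>b\<bar>"] by simp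
    moreover have "0 \<le> \<bar>a\<bar> * \<bar>b\<bar>" by simp
    ultimately show ?thesis unfolding abs_mult by linarith
  qed
  then show "AE x in M. norm (f x * g x) \<le> norm ((f x)\<^sup>2 + (g x)\<^sup>2)"
    by simp
qed

lemma inner_L2_commute: "inner_L2 \<Omega> u v = inner_L2 \<Omega> v u"
  by (simp add: inner_L2_def mult.commute)

lemma inner_L2_self_nonneg: "0 \<le> inner_L2 \<Omega> u u"
  by (simp add: inner_L2_def)

lemma inner_L2_lincomb_right:
  assumes "square_integrable (lebesgue_on \<Omega>) f"
    and "square_integrable (lebesgue_on \<Omega>) u" "square_integrable (lebesgue_on \<Omega>) v"
  shows "inner_L2 \<Omega> f (\<lambda>x. a * u x + b * v x) = a * inner_L2 \<Omega> f u + b * inner_L2 \<Omega> f v"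
proof -
  have "inner_L2 \<Omega> f (\<lambda>x. a * u x + b * v x)
      = (LINT x|lebesgue_on \<Omega>. a * (f x * u x) + b * (f x * v x))"
    by (simp add: inner_L2_def algebra_simps)
  then show ?thesis
    using assms by (simp add: inner_L2_def integrable_mult_square_integrable)
qed

lemma inner_L2_lincomb_left:
  assumes "square_integrable (lebesgue_on \<Omega>) f"
    and "square_integrable (lebesgue_on \<Omega>) u" "square_integrable (lebesgue_on \<Omega>) v"
  shows "inner_L2 \<Omega> (\<lambda>x. a * u x + b * v x) f = a * inner_L2 \<Omega> u f + b * inner_L2 \<Omega> v f"
  using inner_L2_lincomb_right[OF assms] by (simp add: inner_L2_commute)

lemma inner_L2_ae_zero:
  assumes "ae_eq \<Omega> u (\<lambda>x. 0)"
  shows "inner_L2 \<Omega> u v = 0"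
proof -
  have "AE x in lebesgue_on \<Omega>. u x * v x = 0"
    using assms unfolding ae_eq_def by eventually_elim simp
  then show ?thesis
    unfolding inner_L2_def by (rule integral_eq_zero_AE)
qed

section \<open>Symmetric forms and the three-level identity\<close>

text \<open>
  Linearity in the second argument is the part that the integral provides for any operator; together
  with symmetry it makes the form bilinear.
\<close>
definition symmetric_form_on ::
    "('x \<Rightarrow> real) set \<Rightarrow> (('x \<Rightarrow> real) \<Rightarrow> ('x \<Rightarrow> real) \<Rightarrow> real) \<Rightarrow> bool" where
  "symmetric_form_on V d \<longleftrightarrow>
     (\<forall>u\<in>V. \<forall>v\<in>V. \<forall>a b. (\<lambda>x. a * u x + b * v x) \<in> V) \<and>
     (\<forall>u\<in>V. \<forall>v\<in>V. d u v = d v u) \<and>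
     (\<forall>f\<in>V. \<forall>u\<in>V. \<forall>v\<in>V. \<forall>a b. d f (\<lambda>x. a * u x + b * v x) = a * d f u + b * d f v)"

lemma lincomb3_mem:
  assumes "\<And>u v a b. u \<in> V \<Longrightarrow> v \<in> V \<Longrightarrow> (\<lambda>x. a * u x + b * v x) \<in> V"
    and "p \<in> V" "q \<in> V" "r \<in> V"
  shows "(\<lambda>x. a * p x + b * q x + c * r x :: real) \<in> V"
  using assms(1)[OF assms(1)[OF assms(2,3), of a b] assms(4), of 1 c] by simp

lemma symmetric_form_lincomb3:
  fixes p q r :: "'x \<Rightarrow> real"
  assumes d: "symmetric_form_on V d" and V: "p \<in> V" "q \<in> V" "r \<in> V"
  defines "L \<equiv> \<lambda>a b c x. a * p x + b * q x + c * r x"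
  shows "d (L a b c) (L a' b' c') =
    a * a' * d p p + b * b' * d q q + c * c' * d r r +
    (a * b' + b * a') * d p q + (a * c' + c * a') * d p r + (b * c' + c * b') * d q r"
proof -
  have lin: "(\<lambda>x. a * u x + b * v x) \<in> V" if "u \<in> V" "v \<in> V" for u v a b
    using d that by (simp add: symmetric_form_on_def)
  have L: "L a b c \<in> V" for a b c
    unfolding L_def by (rule lincomb3_mem) (fact lin V)+
  have right: "d f (L a b c) = a * d f p + b * d f q + c * d f r" if "f \<in> V" for f a b c
  proof -
    define s where "s = (\<lambda>x. a * p x + b * q x)"
    have "s \<in> V" and s: "d f s = a * d f p + b * d f q"
      using d V that by (auto simp: s_def symmetric_form_on_def)
    then have "d f (\<lambda>x. 1 * s x + c * r x) = 1 * d f s + c * d f r"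
      using d V that unfolding symmetric_form_on_def by blast
    then show ?thesis using s by (simp add: s_def L_def)
  qed
  have sym: "d u v = d v u" if "u \<in> V" "v \<in> V" for u v
    using d that by (simp add: symmetric_form_on_def)
  have left: "d (L a b c) f = a * d p f + b * d q f + c * d r f" if "f \<in> V" for f
    using right[OF that, of a b c] unfolding sym[OF that L] sym[OF that V(1)] sym[OF that V(2)]
      sym[OF that V(3)] .
  show ?thesis
    unfolding left[OF L] right[OF V(1)] right[OF V(2)] right[OF V(3)]
    using sym[OF V(2,1)] sym[OF V(3,1)] sym[OF V(3,2)] by (simp add: algebra_simps)
qed

text \<open>
  For a symmetric form the cross terms of \<open>d (s + t) (s - t)\<close> cancel. This is applied to the
  sums \<open>p + q\<close>, \<open>q + r\<close> with weight \<open>1/4\<close> and to the increments \<open>p - q\<close>, \<open>q - r\<close> with weight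
  \<open>\<sigma> - 1/4\<close>; these are the weights for which the two parts add up to the weighted average on the left.
\<close>
lemma symmetric_form_three_level_identity:
  fixes p q r :: "'x \<Rightarrow> real"
  assumes d: "symmetric_form_on V d" and V: "p \<in> V" "q \<in> V" "r \<in> V"
  shows "d (\<lambda>x. \<sigma> * p x + (1 - 2 * \<sigma>) * q x + \<sigma> * r x) (\<lambda>x. p x - r x) =
    (1 / 4 * d (\<lambda>x. p x + q x) (\<lambda>x. p x + q x) +
      (\<sigma> - 1 / 4) * d (\<lambda>x. p x - q x) (\<lambda>x. p x - q x)) -
    (1 / 4 * d (\<lambda>x. q x + r x) (\<lambda>x. q x + r x) +
      (\<sigma> - 1 / 4) * d (\<lambda>x. q x - r x) (\<lambda>x. q x - r x))"
proof -
  define L where "L a b c = (\<lambda>x. a * p x + b * q x + c * r x)" for a b c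
  note expand = symmetric_form_lincomb3[OF d V, folded L_def]
  have "(\<lambda>x. \<sigma> * p x + (1 - 2 * \<sigma>) * q x + \<sigma> * r x) = L \<sigma> (1 - 2 * \<sigma>) \<sigma>"
    "(\<lambda>x. p x - r x) = L 1 0 (- 1)"
    "(\<lambda>x. p x + q x) = L 1 1 0" "(\<lambda>x. p x - q x) = L 1 (- 1) 0"
    "(\<lambda>x. q x + r x) = L 0 1 1" "(\<lambda>x. q x - r x) = L 0 1 (- 1)"
    by (simp_all add: L_def)
  note forms = this
  show ?thesis unfolding forms expand by (simp add: field_simps)
qed

section \<open>The operators of the scheme\<close>

lemma finite_element_space_lincomb:
  assumes "finite_element_space \<Omega> V" "u \<in> V" "v \<in> V"
  shows "(\<lambda>x. a * u x + b * v x) \<in> V"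
  using assms by (simp add: finite_element_space_def)

lemma finite_element_space_square_integrable:
  assumes "finite_element_space \<Omega> V" "u \<in> V"
  shows "square_integrable (lebesgue_on \<Omega>) u"
  using assms by (auto simp: finite_element_space_def sobolev_H1_def)

lemma op_D_mem:
  assumes "finite_element_space \<Omega> V" "\<And>u. u \<in> V \<Longrightarrow> A u \<in> V" "u \<in> V"
  shows "op_D \<delta> A u \<in> V"
  using finite_element_space_lincomb[OF assms(1) assms(2)[OF assms(3)] assms(3), of 1 "- \<delta>"]
  by (simp add: op_D_def)

lemma op_B_mem:
  assumes "finite_element_space \<Omega> V" "\<And>u. u \<in> V \<Longrightarrow> A u \<in> V" "u \<in> V"
  shows "op_B \<alpha> \<delta> A t u \<in> V"
proof -
  have "op_D \<delta> A u \<in> V"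
    by (rule op_D_mem) (fact assms)+
  from finite_element_space_lincomb[OF assms(1) this assms(3), of "t / \<alpha>" "\<delta> / \<alpha>"]
  show ?thesis by (simp add: op_B_def algebra_simps)
qed

lemma inner_L2_op_D:
  assumes V: "finite_element_space \<Omega> V" and A: "\<And>u. u \<in> V \<Longrightarrow> A u \<in> V"
    and u: "u \<in> V" and v: "v \<in> V"
  shows "inner_L2 \<Omega> (op_D \<delta> A u) v = inner_L2 \<Omega> (A u) v - \<delta> * inner_L2 \<Omega> u v"
  using inner_L2_lincomb_left[of \<Omega> v "A u" u 1 "- \<delta>"]
    finite_element_space_square_integrable[OF V] A[OF u] u v
  by (simp add: op_D_def)

lemma symmetric_form_op_D:
  assumes V: "finite_element_space \<Omega> V" and A: "\<And>u. u \<in> V \<Longrightarrow> A u \<in> V"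
    and sa: "self_adjoint_on \<Omega> V A"
  shows "symmetric_form_on V (\<lambda>u. inner_L2 \<Omega> (op_D \<delta> A u))"
  unfolding symmetric_form_on_def
proof (intro conjI ballI allI)
  fix u v assume uv: "u \<in> V" "v \<in> V"
  have "inner_L2 \<Omega> (A u) v = inner_L2 \<Omega> (A v) u"
    using sa uv inner_L2_commute[of \<Omega> u "A v"] by (simp add: self_adjoint_on_def)
  then show "inner_L2 \<Omega> (op_D \<delta> A u) v = inner_L2 \<Omega> (op_D \<delta> A v) u"
    using uv inner_L2_commute[of \<Omega> u v] by (simp add: inner_L2_op_D[OF V A])
next
  fix f u v a b assume "f \<in> V" "u \<in> V" "v \<in> V"
  then show "inner_L2 \<Omega> (op_D \<delta> A f) (\<lambda>x. a * u x + b * v x) =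
      a * inner_L2 \<Omega> (op_D \<delta> A f) u + b * inner_L2 \<Omega> (op_D \<delta> A f) v"
    using op_D_mem[OF V A] finite_element_space_square_integrable[OF V]
    by (intro inner_L2_lincomb_right) auto
qed (rule finite_element_space_lincomb[OF V])

text \<open>
  Coercivity speaks only of functions that do not vanish almost everywhere; for the others the
  integral is zero, whatever the value of the operator.
\<close>
lemma op_D_nonneg:
  assumes V: "finite_element_space \<Omega> V" and A: "\<And>u. u \<in> V \<Longrightarrow> A u \<in> V"
    and coercive: "\<And>u. u \<in> V \<Longrightarrow> \<not> ae_eq \<Omega> u (\<lambda>x. 0) \<Longrightarrow>
      inner_L2 \<Omega> (A u) u > \<delta> * (norm_L2 \<Omega> u)\<^sup>2"
    and u: "u \<in> V"
  shows "0 \<le> inner_L2 \<Omega> (op_D \<delta> A u) u"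
proof (cases "ae_eq \<Omega> u (\<lambda>x. 0)")
  case True
  then show ?thesis
    using inner_L2_ae_zero[OF True, of "op_D \<delta> A u"] by (simp add: inner_L2_commute)
next
  case False
  then show ?thesis
    using coercive[OF u] by (simp add: inner_L2_op_D[OF V A u u] norm_L2_def inner_L2_self_nonneg)
qed

text \<open>
  The scalar \<open>s\<close> is \<open>1 / (2\<tau>)\<close> in the scheme. It sits inside the argument of \<open>A\<close>, which may
  fail to commute with it on representatives; by symmetry of the form it can be moved to the
  second argument, where it factors out of the integral.
\<close>
lemma op_B_scaled_nonneg:
  assumes V: "finite_element_space \<Omega> V" and A: "\<And>u. u \<in> V \<Longrightarrow> A u \<in> V"
    and sa: "self_adjoint_on \<Omega> V A"
    and nonneg: "0 \<le> inner_L2 \<Omega> (op_D \<delta> A v) v"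
    and coeffs: "0 < \<alpha>" "0 \<le> \<delta>" "0 \<le> t" "0 \<le> s"
    and v: "v \<in> V"
  shows "0 \<le> inner_L2 \<Omega> (op_B \<alpha> \<delta> A t (\<lambda>x. s * v x)) v"
proof -
  define u where "u = (\<lambda>x. s * v x)"
  have u: "u \<in> V"
    using finite_element_space_lincomb[OF V v v, of s 0] by (simp add: u_def)
  note D = symmetric_form_op_D[OF V A sa, where \<delta> = \<delta>, unfolded symmetric_form_on_def]
  have "inner_L2 \<Omega> (op_D \<delta> A u) v = inner_L2 \<Omega> (op_D \<delta> A v) (\<lambda>x. s * v x + 0 * v x)"
    using D u v by (simp add: u_def)
  also have "\<dots> = s * inner_L2 \<Omega> (op_D \<delta> A v) v + 0 * inner_L2 \<Omega> (op_D \<delta> A v) v"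
    using D v by blast
  finally have Du: "inner_L2 \<Omega> (op_D \<delta> A u) v = s * inner_L2 \<Omega> (op_D \<delta> A v) v" by simp
  have uv: "inner_L2 \<Omega> u v = s * inner_L2 \<Omega> v v"
    by (simp add: u_def inner_L2_def mult.assoc)
  have "inner_L2 \<Omega> (op_B \<alpha> \<delta> A t u) v =
      t / \<alpha> * inner_L2 \<Omega> (op_D \<delta> A u) v + \<delta> / \<alpha> * inner_L2 \<Omega> u v"
    using inner_L2_lincomb_left[of \<Omega> v "op_D \<delta> A u" u "t / \<alpha>" "\<delta> / \<alpha>"]
      finite_element_space_square_integrable[OF V] op_D_mem[OF V A u] u v
    by (simp add: op_B_def algebra_simps)
  then show ?thesis
    unfolding Du uv unfolding u_def using coeffs nonneg by (simp add: inner_L2_self_nonneg)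
qed

text \<open>
  The square root in the norm returns its argument only where the form is nonnegative, which is
  where positivity of \<open>D\<close> is needed to pass from the form to the energy.
\<close>
lemma energy_eq_form:
  assumes "\<And>u. u \<in> V \<Longrightarrow> 0 \<le> inner_L2 \<Omega> (D u) u"
    and V: "finite_element_space \<Omega> V" and w: "w n \<in> V" "w (n - 1) \<in> V"
  shows "energy \<Omega> D \<sigma> w n =
    1 / 4 * inner_L2 \<Omega> (D (\<lambda>x. w n x + w (n - 1) x)) (\<lambda>x. w n x + w (n - 1) x) +
    (\<sigma> - 1 / 4) * inner_L2 \<Omega> (D (\<lambda>x. w n x - w (n - 1) x)) (\<lambda>x. w n x - w (n - 1) x)"
proof -
  have "(\<lambda>x. w n x + w (n - 1) x) \<in> V" "(\<lambda>x. w n x - w (n - 1) x) \<in> V"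
    using finite_element_space_lincomb[OF V w, of 1 1]
      finite_element_space_lincomb[OF V w, of 1 "-1"] by simp_all
  then show ?thesis using assms(1) by (simp add: energy_def op_norm_def)
qed

section \<open>Unconditional stability\<close>

theorem theorem3:
  fixes \<Omega> :: "(real ^ 'n::finite) set"
    and V :: "(real ^ 'n \<Rightarrow> real) set"
    and k c \<mu> \<psi> w\<^sub>1 :: "real ^ 'n \<Rightarrow> real"
    and A :: "'n operator"
    and k\<^sub>1 k\<^sub>2 c\<^sub>0 \<delta> \<alpha> \<sigma>\<^sub>0 :: real
  assumes "CARD('n) = 2 \<or> CARD('n) = 3"
    and "bounded_lipschitz_domain \<Omega>"
    and "finite_element_space \<Omega> V"
    and "0 < k\<^sub>1" and "\<And>x. x \<in> \<Omega> \<Longrightarrow> k\<^sub>1 \<le> k x \<and> k x \<le> k\<^sub>2"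
    and "0 < c\<^sub>0" and "\<And>x. x \<in> \<Omega> \<Longrightarrow> c\<^sub>0 \<le> c x"
    and "\<And>x. x \<in> frontier \<Omega> \<Longrightarrow> 0 \<le> \<mu> x"
    and "discrete_elliptic_operator \<Omega> V k c \<mu> A"
    and "self_adjoint_on \<Omega> V A"
    and "0 < \<delta>"
    and "\<And>u. u \<in> V \<Longrightarrow> \<not> ae_eq \<Omega> u (\<lambda>x. 0) \<Longrightarrow> inner_L2 \<Omega> (A u) u > \<delta> * (norm_L2 \<Omega> u)\<^sup>2"
    and "0 < \<alpha>" and "\<alpha> < 1"
    and "\<psi> \<in> V" and "w\<^sub>1 \<in> V"
    and "\<sigma>\<^sub>0 = (2 + \<alpha>) / (6 * \<alpha>)"
  shows "\<sigma>\<^sub>0 > 1 / 4 \<and>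
    (\<forall>N \<tau> w. N \<ge> 2 \<longrightarrow> \<tau> = 1 / real N \<longrightarrow>
       (\<forall>n\<le>N. w n \<in> V) \<longrightarrow>
       ae_eq \<Omega> (w 0) (\<lambda>x. \<delta> powr (- \<alpha>) * \<psi> x) \<longrightarrow>
       ae_eq \<Omega> (w 1) w\<^sub>1 \<longrightarrow>
       three_level_scheme \<Omega> \<alpha> \<delta> A \<sigma>\<^sub>0 N \<tau> w \<longrightarrow>
       (\<forall>n\<in>{1..N - 1}. energy \<Omega> (op_D \<delta> A) \<sigma>\<^sub>0 w (n + 1) \<le> energy \<Omega> (op_D \<delta> A) \<sigma>\<^sub>0 w n))"
proof (intro conjI allI impI ballI)
  show "\<sigma>\<^sub>0 > 1 / 4"
    unfolding assms(17) using assms(13,14) by (simp add: field_simps)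
next
  fix N :: nat and \<tau> :: real and w :: "nat \<Rightarrow> real ^ 'n \<Rightarrow> real" and n :: nat
  assume N: "N \<ge> 2" and \<tau>: "\<tau> = 1 / real N" and wV: "\<forall>n\<le>N. w n \<in> V"
    and scheme: "three_level_scheme \<Omega> \<alpha> \<delta> A \<sigma>\<^sub>0 N \<tau> w" and n: "n \<in> {1..N - 1}"
  note V = assms(3)
  have A: "A u \<in> V" if "u \<in> V" for u
    using assms(9) that by (simp add: discrete_elliptic_operator_def)
  note D_nonneg = op_D_nonneg[OF V A assms(12)]
  have w: "w (n + 1) \<in> V" "w n \<in> V" "w (n - 1) \<in> V"
    using wV n N by auto
  have \<tau>0: "0 < \<tau>" using N \<tau> by simp
  define v where "v = (\<lambda>x. w (n + 1) x - w (n - 1) x)"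
  define y where "y = (\<lambda>x. \<sigma>\<^sub>0 * w (n + 1) x + (1 - 2 * \<sigma>\<^sub>0) * w n x + \<sigma>\<^sub>0 * w (n - 1) x)"
  define b where "b = op_B \<alpha> \<delta> A (real n * \<tau>) (\<lambda>x. 1 / (2 * \<tau>) * v x)"
  have v: "v \<in> V"
    using finite_element_space_lincomb[OF V w(1,3), of 1 "-1"] by (simp add: v_def)
  have y: "y \<in> V"
    unfolding y_def by (rule lincomb3_mem) (fact finite_element_space_lincomb[OF V] w)+
  have b: "b \<in> V"
    unfolding b_def using finite_element_space_lincomb[OF V v v, of "1 / (2 * \<tau>)" 0]
    by (intro op_B_mem[OF V A]) simp_all
  have "ae_eq \<Omega> (\<lambda>x. b x + op_D \<delta> A y x) (\<lambda>x. 0)"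
    using scheme n by (simp add: three_level_scheme_def b_def y_def v_def)
  then have "inner_L2 \<Omega> (\<lambda>x. b x + op_D \<delta> A y x) v = 0"
    by (rule inner_L2_ae_zero)
  then have tested: "inner_L2 \<Omega> b v + inner_L2 \<Omega> (op_D \<delta> A y) v = 0"
    using inner_L2_lincomb_left[of \<Omega> v b "op_D \<delta> A y" 1 1]
      finite_element_space_square_integrable[OF V] b v op_D_mem[OF V A y]
    by simp
  have "0 \<le> inner_L2 \<Omega> b v"
    unfolding b_def
    using assms(11,13) \<tau>0 by (intro op_B_scaled_nonneg[OF V A assms(10) D_nonneg]) (auto intro: v)
  moreover have "inner_L2 \<Omega> (op_D \<delta> A y) v =
      energy \<Omega> (op_D \<delta> A) \<sigma>\<^sub>0 w (n + 1) - energy \<Omega> (op_D \<delta> A) \<sigma>\<^sub>0 w n"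
    using symmetric_form_three_level_identity[OF symmetric_form_op_D[OF V A assms(10), where \<delta> = \<delta>] w,
        of "\<sigma>\<^sub>0"]
      energy_eq_form[of V \<Omega> "op_D \<delta> A" w "n + 1" "\<sigma>\<^sub>0"]
      energy_eq_form[of V \<Omega> "op_D \<delta> A" w n "\<sigma>\<^sub>0"] D_nonneg V w
    by (simp add: y_def v_def)
  ultimately show "energy \<Omega> (op_D \<delta> A) \<sigma>\<^sub>0 w (n + 1) \<le> energy \<Omega> (op_D \<delta> A) \<sigma>\<^sub>0 w n"
    using tested by linarith
qed

end
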